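(* For any JumpOpt local optimum $x$ of the scheduling problem $R\,||\sum w_jC_j$, there exists a feasible solution of (SDP-SR) with objective value at least $\frac{2}{3+\sqrt5}\,C(x)$.
   Context: $R\,||\sum w_jC_j$: a finite set $J$ of jobs with weights $w_j\ge 0$, a finite set $M$ of machines, processing times $p_{ij}\in\mathbb R_{\ge0}\cup\{\infty\}$, and $\mathcal S_j=\{i\in M:p_{ij}<\infty\}\neq\emptyset$. Smith ratios: $\delta_{ij}=p_{ij}/w_j$, read as $+\infty$ if $w_j=0$. For each machine $i$, $\prec_i$ is a strict total order on $J$ such that $k\prec_i j$ implies $\delta_{ik}\le\delta_{ij}$ (ties broken consistently). An assignment is $x\in\{0,1\}^{M\times J}$ with $\sum_{i\in\mathcal S_j}x_{ij}=1$ and $x_{ij}=0$ for $i\notin\mathcal S_j$, for every $j\in J$. Completion times: $C_j(x)=\sum_{i\in M}x_{ij}\big(p_{ij}+\sum_{k\prec_i j}p_{ik}x_{ik}\big)$. Cost: $C(x)=\sum_{j\in J}w_jC_j(x)$. Any term with a zero factor $x_{ij}$ or $w_j$ is read as $0$. JumpOpt: an assignment $x$ such that moving any single job to any other of its feasible machines does not strictly decrease $C$. (SDP-SR): the variables are reals $y_j$ $(j\in J)$ and vectors $v_0,v_{ij}\in\mathbb R^d$ $(j\in J,i\in\mathcal S_j)$ for some $d\in\mathbb N$, with the standard inner product. Maximize $\sum_{j\in J}y_j-\frac12\|v_0\|^2$ subject to $y_j\le w_jp_{ij}-\frac12\|v_{ij}\|^2+\langle v_0,v_{ij}\rangle$ for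 all $j\in J$, $i\in\mathcal S_j$; and $\langle v_{ij},v_{i'k}\rangle\le w_jw_k\min\{\delta_{ij},\delta_{ik}\}\,\mathbf 1_{\{i=i'\}}$ for all $(i,j)\ne(i',k)$ with $j,k\in J$, $i\in\mathcal S_j$, $i'\in\mathcal S_k$ (right-hand side $0$ if $i\ne i'$). *)

theory Defs
  imports Complex_Main "HOL-Library.Extended_Real" "Jordan_Normal_Form.Matrix"
begin

text \<open>
  An instance consists of a job set \<open>J\<close>, a machine set \<open>M\<close>, weights \<open>w\<close> and processing
  times \<open>p i j\<close> (machine first). Nonnegativity of weights and processing times is
  assumed separately. The value \<open>\<infinity>\<close> marks a job that cannot run on a machine; the
  convention that a term with a zero factor is zero is \<^term>\<open>0 * (\<infinity> :: ereal) = 0\<close>.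
\<close>

definition feasible_machines ::
  "'m set \<Rightarrow> ('m \<Rightarrow> 'j \<Rightarrow> ereal) \<Rightarrow> 'j \<Rightarrow> 'm set"
where
  "feasible_machines M p j = {i \<in> M. p i j < \<infinity>}"

text \<open>The case distinction is needed because \<^term>\<open>0 / 0 = (0 :: ereal)\<close>.\<close>

definition smith_ratio ::
  "('j \<Rightarrow> real) \<Rightarrow> ('m \<Rightarrow> 'j \<Rightarrow> ereal) \<Rightarrow> 'm \<Rightarrow> 'j \<Rightarrow> ereal"
where
  "smith_ratio w p i j = (if w j = 0 then \<infinity> else p i j / ereal (w j))"

definition smith_order ::
  "'j set \<Rightarrow> ('j \<Rightarrow> real) \<Rightarrow> ('m \<Rightarrow> 'j \<Rightarrow> ereal) \<Rightarrow> 'm \<Rightarrow> ('j \<Rightarrow> 'j \<Rightarrow> bool) \<Rightarrow> bool"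
where
  "smith_order J w p i r \<longleftrightarrow>
     irreflp_on J r \<and> transp_on J r \<and> totalp_on J r \<and>
     (\<forall>k\<in>J. \<forall>j\<in>J. r k j \<longrightarrow> smith_ratio w p i k \<le> smith_ratio w p i j)"

definition assignment ::
  "'j set \<Rightarrow> 'm set \<Rightarrow> ('m \<Rightarrow> 'j \<Rightarrow> ereal) \<Rightarrow> ('m \<Rightarrow> 'j \<Rightarrow> real) \<Rightarrow> bool"
where
  "assignment J M p x \<longleftrightarrow>
     (\<forall>i\<in>M. \<forall>j\<in>J. x i j \<in> {0, 1}) \<and>
     (\<forall>j\<in>J. (\<Sum>i\<in>feasible_machines M p j. x i j) = 1 \<and>
            (\<forall>i\<in>M - feasible_machines M p j. x i j = 0))"

definition completion_time ::
  "'j set \<Rightarrow> 'm set \<Rightarrow> ('m \<Rightarrow> 'j \<Rightarrow> ereal) \<Rightarrow> ('m \<Rightarrow> 'j \<Rightarrow> 'j \<Rightarrow> bool)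
   \<Rightarrow> ('m \<Rightarrow> 'j \<Rightarrow> real) \<Rightarrow> 'j \<Rightarrow> ereal"
where
  "completion_time J M p prec x j =
     (\<Sum>i\<in>M. ereal (x i j) * (p i j + (\<Sum>k\<in>{k\<in>J. prec i k j}. p i k * ereal (x i k))))"

definition schedule_cost ::
  "'j set \<Rightarrow> 'm set \<Rightarrow> ('j \<Rightarrow> real) \<Rightarrow> ('m \<Rightarrow> 'j \<Rightarrow> ereal) \<Rightarrow> ('m \<Rightarrow> 'j \<Rightarrow> 'j \<Rightarrow> bool)
   \<Rightarrow> ('m \<Rightarrow> 'j \<Rightarrow> real) \<Rightarrow> ereal"
where
  "schedule_cost J M w p prec x = (\<Sum>j\<in>J. ereal (w j) * completion_time J M p prec x j)"

definition move_job ::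
  "('m \<Rightarrow> 'j \<Rightarrow> real) \<Rightarrow> 'j \<Rightarrow> 'm \<Rightarrow> 'm \<Rightarrow> 'j \<Rightarrow> real"
where
  "move_job x j i' = (\<lambda>i k. if k = j then (if i = i' then 1 else 0) else x i k)"

definition jump_opt ::
  "'j set \<Rightarrow> 'm set \<Rightarrow> ('j \<Rightarrow> real) \<Rightarrow> ('m \<Rightarrow> 'j \<Rightarrow> ereal) \<Rightarrow> ('m \<Rightarrow> 'j \<Rightarrow> 'j \<Rightarrow> bool)
   \<Rightarrow> ('m \<Rightarrow> 'j \<Rightarrow> real) \<Rightarrow> bool"
where
  "jump_opt J M w p prec x \<longleftrightarrow>
     assignment J M p x \<and>
     (\<forall>j\<in>J. \<forall>i\<in>feasible_machines M p j. x i j = 0 \<longrightarrow>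
        \<not> schedule_cost J M w p prec (move_job x j i) < schedule_cost J M w p prec x)"

text \<open>
  The dimension is a free parameter of the program, so vectors are taken in
  \<^term>\<open>carrier_vec d\<close>; the squared Euclidean norm of \<open>u\<close> is the scalar product of \<open>u\<close>
  with itself.
\<close>

definition sdp_sr_feasible ::
  "'j set \<Rightarrow> 'm set \<Rightarrow> ('j \<Rightarrow> real) \<Rightarrow> ('m \<Rightarrow> 'j \<Rightarrow> ereal)
   \<Rightarrow> nat \<Rightarrow> ('j \<Rightarrow> real) \<Rightarrow> real vec \<Rightarrow> ('m \<Rightarrow> 'j \<Rightarrow> real vec) \<Rightarrow> bool"
where
  "sdp_sr_feasible J M w p d y v\<^sub>0 v \<longleftrightarrow>
     v\<^sub>0 \<in> carrier_vec d \<and>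
     (\<forall>j\<in>J. \<forall>i\<in>feasible_machines M p j. v i j \<in> carrier_vec d) \<and>
     (\<forall>j\<in>J. \<forall>i\<in>feasible_machines M p j.
        ereal (y j) \<le> ereal (w j) * p i j - ereal (1 / 2 * (v i j \<bullet> v i j)) + ereal (v\<^sub>0 \<bullet> v i j)) \<and>
     (\<forall>j\<in>J. \<forall>k\<in>J. \<forall>i\<in>feasible_machines M p j. \<forall>i'\<in>feasible_machines M p k.
        (i, j) \<noteq> (i', k) \<longrightarrow>
        ereal (v i j \<bullet> v i' k) \<le>
          (if i = i' then ereal (w j * w k) * min (smith_ratio w p i j) (smith_ratio w p i k) else 0))"

definition sdp_sr_objective ::
  "'j set \<Rightarrow> ('j \<Rightarrow> real) \<Rightarrow> real vec \<Rightarrow> real"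
where
  "sdp_sr_objective J y v\<^sub>0 = (\<Sum>j\<in>J. y j) - 1 / 2 * (v\<^sub>0 \<bullet> v\<^sub>0)"

end

theory Submission
  imports Defs
begin

text \<open>
  The kernel \<open>w j * w k * min (\<delta> i j) (\<delta> i k)\<close> is the Gram matrix of vectors \<open>\<phi> i j\<close> (step
  functions of height \<open>w j\<close> on \<open>[0, \<delta> i j]\<close>, orthogonal for distinct machines). If \<open>F\<close> is the sum
  of \<open>\<phi> (a j) j\<close> over all jobs, \<open>a j\<close> being the machine of \<open>j\<close>, then the cost is half of
  \<open>\<parallel>F\<parallel>\<^sup>2\<close> plus half of the sum of all \<open>\<parallel>\<phi> (a j) j\<parallel>\<^sup>2\<close>, hence at most \<open>\<parallel>F\<parallel>\<^sup>2\<close>, and local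
  optimality says that \<open>\<langle>\<phi> (a j) j, F\<rangle> \<le> w j * p i j + \<langle>\<phi> i j, F\<rangle>\<close> for every feasible \<open>i\<close>.
  Therefore \<open>v i j = \<alpha> \<phi> i j\<close>, \<open>v\<^sub>0 = \<beta> F\<close> and \<open>y j = \<alpha> \<beta> \<langle>\<phi> (a j) j, F\<rangle>\<close> are feasible as
  soon as \<open>\<alpha> \<le> 1\<close> and \<open>\<alpha> \<beta> = 1 - \<alpha>\<^sup>2 / 2\<close>; the objective is \<open>(\<alpha> \<beta> - \<beta>\<^sup>2 / 2) \<parallel>F\<parallel>\<^sup>2\<close>, whose
  factor is largest at \<open>\<alpha>\<^sup>2 = 2 / sqrt 5\<close>, with value \<open>2 / (3 + sqrt 5)\<close>.
\<close>

section \<open>Gram vectors for the minimum kernel\<close>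

text \<open>Take \<open>g t\<close> to be the gap between \<open>t\<close> and its predecessor in
  \<open>T\<close> (or 0 if there is none); the sums telescope. These gaps are the step lengths from
  which the coordinates of the Gram vectors are built.\<close>

lemma ex_cumulative_weights:
  fixes T :: "real set"
  assumes "finite T" and "\<forall>t\<in>T. 0 \<le> t"
  shows "\<exists>g. (\<forall>t\<in>T. 0 \<le> g t) \<and> (\<forall>m\<in>T. (\<Sum>t\<in>{t\<in>T. t \<le> m}. g t) = m)"
  using assms
proof (induction T rule: finite_linorder_max_induct)
  case empty
  then show ?case by simp
next
  case (insert b A)
  then obtain g where g: "\<forall>t\<in>A. 0 \<le> g t" "\<forall>m\<in>A. (\<Sum>t\<in>{t\<in>A. t \<le> m}. g t) = m"
    by auto
  \<comment> \<open>The weights on \<open>A\<close> sum to \<open>Max A\<close>, or to 0 if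
    \<open>A\<close> is empty, so the new gap \<open>b - sum g A\<close> is nonnegative.\<close>
  have le: "sum g A \<le> b"
  proof (cases "A = {}")
    case False
    then have "Max A \<in> A" "{t\<in>A. t \<le> Max A} = A"
      using insert.hyps by auto
    then show ?thesis
      using g(2) insert.hyps by (metis less_imp_le)
  qed (use insert.prems in simp)
  define h where "h = g(b := b - sum g A)"
  have nb: "b \<notin> A" using insert.hyps by auto
  have sum_h: "sum h B = sum g B" if "B \<subseteq> A" for B
    by (rule sum.cong) (use that nb in \<open>auto simp: h_def\<close>)
  have "(\<Sum>t\<in>{t\<in>insert b A. t \<le> m}. h t) = m" if "m \<in> insert b A" for m
  proof (cases "m = b")
    case True
    then have "{t\<in>insert b A. t \<le> m} = insert b A"
      using insert.hyps by auto
    then show ?thesis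
      using True nb insert.hyps sum_h[of A] by (simp add: h_def)
  next
    case False
    then have "m \<in> A" using that by simp
    then have "{t\<in>insert b A. t \<le> m} = {t\<in>A. t \<le> m}"
      using insert.hyps by auto
    then show ?thesis
      using g(2) \<open>m \<in> A\<close> sum_h[of "{t\<in>A. t \<le> m}"] by auto
  qed
  moreover have "\<forall>t\<in>insert b A. 0 \<le> h t"
    using g(1) le by (auto simp: h_def)
  ultimately show ?case by blast
qed

text \<open>Indicator functions of \<open>[0, D s]\<close> have the minimum of the lengths as inner
  product, and disjoint copies of the half-line, one per label \<open>c s\<close>, make different
  blocks orthogonal. Finitely many endpoints occur, so finitely many coordinates suffice.\<close>

lemma ex_gram_min_blocks:
  fixes D :: "'s \<Rightarrow> real" and c :: "'s \<Rightarrow> 'c"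
  assumes fin: "finite S" and nonneg: "\<forall>s\<in>S. 0 \<le> D s"
  shows "\<exists>(d :: nat) f. \<forall>s\<in>S. \<forall>t\<in>S.
           (\<Sum>n<d. f n s * f n t) = (if c s = c t then min (D s) (D t) else 0)"
proof -
  define T where "T = D ` S"
  obtain g where g: "\<forall>t\<in>T. 0 \<le> g t" "\<forall>m\<in>T. (\<Sum>t\<in>{t\<in>T. t \<le> m}. g t) = m"
    using ex_cumulative_weights[of T] fin nonneg by (auto simp: T_def)
  define K where "K = c ` S \<times> T"
  have finT: "finite T" and finK: "finite K"
    using fin by (auto simp: K_def T_def)
  obtain e where e: "bij_betw e {0..<card K} K"
    using ex_bij_betw_nat_finite[OF finK] by blast
  \<comment> \<open>A coordinate \<open>q\<close> is a pair of block and threshold; the square root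
    appears because two coordinates are multiplied to give the weight \<open>g\<close>.\<close>
  define F where "F q s = (if c s = fst q \<and> snd q \<le> D s then sqrt (g (snd q)) else 0)" for q s
  have "(\<Sum>n<card K. F (e n) s * F (e n) t) = (if c s = c t then min (D s) (D t) else 0)"
    if s: "s \<in> S" and t: "t \<in> S" for s t
  proof -
    have "(\<Sum>n<card K. F (e n) s * F (e n) t) = (\<Sum>q\<in>K. F q s * F q t)"
      using sum.reindex_bij_betw[OF e, of "\<lambda>q. F q s * F q t"] by (simp add: atLeast0LessThan)
    also have "\<dots> = (\<Sum>b\<in>c ` S. \<Sum>r\<in>T. F (b, r) s * F (b, r) t)"
      by (simp add: K_def sum.cartesian_product)
    also have "\<dots> = (\<Sum>b\<in>c ` S. if b = c s then
        (if c s = c t then \<Sum>r\<in>T. if r \<le> min (D s) (D t) then g r else 0 else 0) else 0)"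
    proof (intro sum.cong refl)
      fix b
      have "F (b, r) s * F (b, r) t =
          (if b = c s \<and> c s = c t \<and> r \<le> min (D s) (D t) then g r else 0)" if "r \<in> T" for r
        using g(1) that by (auto simp: F_def)
      then show "(\<Sum>r\<in>T. F (b, r) s * F (b, r) t) = (if b = c s then
          (if c s = c t then \<Sum>r\<in>T. if r \<le> min (D s) (D t) then g r else 0 else 0) else 0)"
        by simp
    qed
    also have "\<dots> = (if c s = c t then \<Sum>r\<in>{r\<in>T. r \<le> min (D s) (D t)}. g r else 0)"
      using fin finT s by (simp add: sum.delta' sum.inter_filter)
    also have "\<dots> = (if c s = c t then min (D s) (D t) else 0)"
    proof -
      have "min (D s) (D t) \<in> T" using s t by (auto simp: T_def min_def)
      then show ?thesis using g(2) by auto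
    qed
    finally show ?thesis .
  qed
  then show ?thesis
    by (intro exI[of _ "card K"] exI[of _ "\<lambda>n. F (e n)"]) blast
qed

section \<open>The schedule cost as a quadratic form\<close>

text \<open>Once \<open>x\<close> is the indicator of a map \<open>a\<close>, every possibly
  infinite \<open>p i k\<close> has a zero factor, and the cost becomes a real number.\<close>

lemma schedule_cost_eq:
  fixes J :: "'j set" and M :: "'m set"
  assumes "finite J" and "finite M" and a: "\<forall>j\<in>J. a j \<in> M"
    and P: "\<forall>j\<in>J. p (a j) j = ereal (P (a j) j)"
    and x: "\<forall>i\<in>M. \<forall>j\<in>J. x i j = (if i = a j then 1 else 0)"
  shows "schedule_cost J M w p prec x =
    ereal (\<Sum>j\<in>J. w j * (P (a j) j + (\<Sum>k\<in>{k\<in>J. prec (a j) k j}. if a k = a j then P (a j) k else 0)))"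
proof -
  have "completion_time J M p prec x j =
      ereal (P (a j) j + (\<Sum>k\<in>{k\<in>J. prec (a j) k j}. if a k = a j then P (a j) k else 0))"
    if j: "j \<in> J" for j
  proof -
    have "completion_time J M p prec x j = (\<Sum>i\<in>M. if i = a j then
        p i j + (\<Sum>k\<in>{k\<in>J. prec i k j}. p i k * ereal (x i k)) else 0)"
      unfolding completion_time_def using x j
      by (intro sum.cong) (auto simp flip: one_ereal_def zero_ereal_def)
    also have "\<dots> = p (a j) j + (\<Sum>k\<in>{k\<in>J. prec (a j) k j}. p (a j) k * ereal (x (a j) k))"
      using assms j by (simp add: sum.delta')
    also have "(\<Sum>k\<in>{k\<in>J. prec (a j) k j}. p (a j) k * ereal (x (a j) k)) =
        (\<Sum>k\<in>{k\<in>J. prec (a j) k j}. ereal (if a k = a j then P (a j) k else 0))"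
    proof (intro sum.cong refl)
      fix k assume "k \<in> {k\<in>J. prec (a j) k j}"
      then show "p (a j) k * ereal (x (a j) k) = ereal (if a k = a j then P (a j) k else 0)"
        using P[rule_format, of k] a j x
        by (cases "a k = a j") (auto simp flip: one_ereal_def zero_ereal_def)
    qed
    finally show ?thesis using P j by simp
  qed
  then show ?thesis
    by (simp add: schedule_cost_def)
qed

text \<open>By symmetry each pair of distinct indices can be counted in either direction.
  Comparability is asked only where \<open>H\<close> is nonzero, because the relation used later
  takes the order of the machine of its second argument and is an order only among jobs sharing a
  machine.\<close>

lemma sum_ordered_pairs:
  fixes H :: "'j \<Rightarrow> 'j \<Rightarrow> real"
  assumes fin: "finite J"
    and sym: "\<And>j k. H j k = H k j"
    and ord: "\<And>j k. j \<in> J \<Longrightarrow> k \<in> J \<Longrightarrow> j \<noteq> k \<Longrightarrow> H j k \<noteq> 0 \<Longrightarrow> r j k \<longleftrightarrow> \<not> r k j"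
    and irr: "\<And>j. j \<in> J \<Longrightarrow> \<not> r j j"
  shows "2 * (\<Sum>j\<in>J. \<Sum>k\<in>{k\<in>J. r k j}. H j k) = (\<Sum>j\<in>J. \<Sum>k\<in>J. H j k) - (\<Sum>j\<in>J. H j j)"
proof -
  have eq: "(\<Sum>j\<in>J. \<Sum>k\<in>{k\<in>J. r k j}. H j k) = (\<Sum>j\<in>J. \<Sum>k\<in>J. if r k j then H j k else 0)"
    using fin by (simp add: sum.inter_filter)
  have eq': "\<dots> = (\<Sum>j\<in>J. \<Sum>k\<in>J. if r j k then H j k else 0)"
    by (subst sum.swap, intro sum.cong refl if_cong sym)
  have "2 * (\<Sum>j\<in>J. \<Sum>k\<in>{k\<in>J. r k j}. H j k)
      = (\<Sum>j\<in>J. \<Sum>k\<in>J. (if r k j then H j k else 0) + (if r j k then H j k else 0))"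
    using eq eq' by (simp add: sum.distrib)
  also have "\<dots> = (\<Sum>j\<in>J. \<Sum>k\<in>J. H j k - (if j = k then H j j else 0))"
  proof (intro sum.cong refl)
    fix j k assume "j \<in> J" "k \<in> J"
    then show "(if r k j then H j k else 0) + (if r j k then H j k else 0)
        = H j k - (if j = k then H j j else 0)"
      using ord[of j k] irr[of j] by auto
  qed
  also have "\<dots> = (\<Sum>j\<in>J. \<Sum>k\<in>J. H j k) - (\<Sum>j\<in>J. H j j)"
    using fin by (simp add: sum_subtractf)
  finally show ?thesis .
qed

text \<open>For the minimum kernel \<open>G\<close> this is the Gram matrix of the vectors
  \<open>\<phi> (a j) j\<close>.\<close>

definition machine_kernel ::
  "('j \<Rightarrow> 'm) \<Rightarrow> ('m \<Rightarrow> 'j \<Rightarrow> 'j \<Rightarrow> real) \<Rightarrow> 'j \<Rightarrow> 'j \<Rightarrow> real"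
where
  "machine_kernel a G j k = (if a k = a j then G (a j) j k else 0)"

text \<open>For symmetric \<open>G\<close>, each unordered pair of jobs counts once, the diagonal
  included.\<close>

definition kernel_cost ::
  "'j set \<Rightarrow> ('j \<Rightarrow> 'm) \<Rightarrow> ('m \<Rightarrow> 'j \<Rightarrow> 'j \<Rightarrow> real) \<Rightarrow> real"
where
  "kernel_cost J a G =
     ((\<Sum>j\<in>J. \<Sum>k\<in>J. machine_kernel a G j k) + (\<Sum>j\<in>J. machine_kernel a G j j)) / 2"

lemma machine_kernel_sym:
  assumes "\<And>i j k. G i j k = G i k j"
  shows "machine_kernel a G j k = machine_kernel a G k j"
  using assms by (auto simp: machine_kernel_def)

text \<open>The new row and column agree, so halving leaves one row; the new diagonal entry occurs
  both in the double sum and in the trace and survives in full.\<close>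

lemma kernel_cost_insert:
  assumes "finite J" and "j \<notin> J" and sym: "\<And>i j k. G i j k = G i k j"
  shows "kernel_cost (insert j J) a G =
    kernel_cost J a G + (\<Sum>k\<in>J. machine_kernel a G j k) + machine_kernel a G j j"
proof -
  have "(\<Sum>k\<in>J. machine_kernel a G k j) = (\<Sum>k\<in>J. machine_kernel a G j k)"
    by (intro sum.cong refl machine_kernel_sym sym)
  then show ?thesis
    using assms(1,2) by (simp add: kernel_cost_def sum.distrib field_simps)
qed

text \<open>Take \<open>j\<close> out and insert it again: the cost of the other jobs is unchanged,
  so only the two insertion costs differ. The self-term on \<open>i\<close> stands apart because
  \<open>a j \<noteq> i\<close>, while the sum for the old machine already contains its own.\<close>

lemma kernel_cost_move:
  assumes "finite J" and "j \<in> J" and sym: "\<And>i j k. G i j k = G i k j"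
    and "i \<noteq> a j"
  shows "kernel_cost J (a(j := i)) G - kernel_cost J a G =
    (\<Sum>k\<in>J. if a k = i then G i j k else 0) + G i j j - (\<Sum>k\<in>J. if a k = a j then G (a j) j k else 0)"
proof -
  let ?J = "J - {j}"
  have J: "J = insert j ?J" and fin: "finite ?J" and nj: "j \<notin> ?J"
    using assms by auto
  have cong: "machine_kernel (a(j := i)) G k l = machine_kernel a G k l" if "k \<in> ?J" "l \<in> ?J" for k l
    using that by (auto simp: machine_kernel_def)
  have rest: "kernel_cost ?J (a(j := i)) G = kernel_cost ?J a G"
    using cong by (simp add: kernel_cost_def)
  have moved: "(\<Sum>k\<in>?J. machine_kernel (a(j := i)) G j k) = (\<Sum>k\<in>?J. if a k = i then G i j k else 0)"
    by (intro sum.cong) (auto simp: machine_kernel_def)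
  have split: "sum h J = h j + sum h ?J" for h :: "_ \<Rightarrow> real"
    using assms by (simp add: sum.remove)
  have "kernel_cost J b G = kernel_cost ?J b G + (\<Sum>k\<in>?J. machine_kernel b G j k) + machine_kernel b G j j"
    for b
    using kernel_cost_insert[OF fin nj sym, of b] J by simp
  from this[of a] this[of "a(j := i)"] show ?thesis
    using rest moved assms(4) by (simp add: split machine_kernel_def)
qed

text \<open>If \<open>k\<close> precedes \<open>j\<close> on their machine, the minimum of the
  ratios is that of \<open>k\<close>, so \<open>w j * P (a j) k\<close> is a kernel entry. Symmetry
  then turns the ordered sum into half of the full one.\<close>

lemma schedule_cost_eq_kernel_cost:
  fixes J :: "'j set" and M :: "'m set" and p :: "'m \<Rightarrow> 'j \<Rightarrow> ereal"
  assumes fin: "finite J" "finite M" and a: "\<forall>j\<in>J. a j \<in> M"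
    and P: "\<forall>j\<in>J. p (a j) j = ereal (P (a j) j)"
    and x: "\<forall>i\<in>M. \<forall>j\<in>J. x i j = (if i = a j then 1 else 0)"
    and w: "\<forall>j\<in>J. 0 \<le> w j"
    and ord: "\<forall>i\<in>M. smith_order J w p i (prec i)"
    and G: "\<And>i j k. G i j k = w j * w k * min (P i j / w j) (P i k / w k)"
  shows "schedule_cost J M w p prec x = ereal (kernel_cost J a G)"
proof -
  let ?H = "machine_kernel a G"
  have diag: "w j * P (a j) j = ?H j j" if "j \<in> J" for j
    by (simp add: machine_kernel_def G)
  have off: "w j * (if a k = a j then P (a j) k else 0) = ?H j k"
    if j: "j \<in> J" and k: "k \<in> J" and r: "prec (a j) k j" for j k
  \<comment> \<open>If \<open>w j \<noteq> 0\<close>, the ratio of \<open>j\<close> is finite, so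
    the earlier job \<open>k\<close> cannot have weight 0, which would make its ratio infinite. In
    the other case both sides are 0.\<close>
  proof (cases "a k = a j \<and> w j \<noteq> 0")
    case True
    have "smith_ratio w p (a j) k \<le> smith_ratio w p (a j) j"
      using ord a j k r by (auto simp: smith_order_def)
    moreover have "p (a j) k = ereal (P (a j) k)" "p (a j) j = ereal (P (a j) j)"
      using P j k True by metis+
    ultimately have "w k \<noteq> 0" "P (a j) k / w k \<le> P (a j) j / w j"
      using True by (auto simp: smith_ratio_def split: if_splits)
    then show ?thesis
      using True by (simp add: machine_kernel_def G min_def)
  qed (auto simp: machine_kernel_def G)
  have sym: "G i j k = G i k j" for i j k
    by (simp add: G min.commute mult.commute)
  have "2 * (\<Sum>j\<in>J. \<Sum>k\<in>{k\<in>J. prec (a j) k j}. ?H j k) =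
      (\<Sum>j\<in>J. \<Sum>k\<in>J. ?H j k) - (\<Sum>j\<in>J. ?H j j)"
  proof (rule sum_ordered_pairs[OF fin(1)])
    show "?H j k = ?H k j" for j k by (rule machine_kernel_sym[OF sym])
    show "\<not> prec (a j) j j" if "j \<in> J" for j
      using ord a that by (auto simp: smith_order_def irreflp_on_def)
    show "prec (a k) j k \<longleftrightarrow> \<not> prec (a j) k j"
      if "j \<in> J" "k \<in> J" "j \<noteq> k" "?H j k \<noteq> 0" for j k
    proof -
      have "a k = a j" using that(4) by (auto simp: machine_kernel_def split: if_splits)
      moreover have "smith_order J w p (a j) (prec (a j))" using ord a that by auto
      ultimately show ?thesis
        using that unfolding smith_order_def irreflp_on_def transp_on_def totalp_on_def by metis
    qed
  qed
  moreover have "schedule_cost J M w p prec x =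
      ereal (\<Sum>j\<in>J. ?H j j + (\<Sum>k\<in>{k\<in>J. prec (a j) k j}. ?H j k))"
    unfolding schedule_cost_eq[where p = p and P = P, OF fin a P x] using diag off
    by (simp add: distrib_left sum_distrib_left)
  ultimately show ?thesis
    by (simp add: kernel_cost_def sum.distrib)
qed

section \<open>Assignments as maps, and local optimality\<close>

lemma assignment_machine:
  assumes "finite M" and asg: "assignment J M p x" and j: "j \<in> J"
  shows "\<exists>i\<in>feasible_machines M p j. \<forall>i'\<in>M. x i' j = (if i' = i then 1 else 0)"
proof -
  let ?S = "feasible_machines M p j"
  have sub: "?S \<subseteq> M" by (auto simp: feasible_machines_def)
  then have fin: "finite ?S" using assms finite_subset by blast
  have s: "sum (\<lambda>i. x i j) ?S = 1" and out: "\<And>i. i \<in> M - ?S \<Longrightarrow> x i j = 0"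
    and bin: "\<And>i. i \<in> M \<Longrightarrow> x i j = 0 \<or> x i j = 1"
    using asg j by (auto simp: assignment_def)
  obtain i where i: "i \<in> ?S" "x i j \<noteq> 0"
    using s by (metis sum.neutral zero_neq_one)
  then have i1: "x i j = 1" using bin sub by auto
  have "x i' j = 0" if "i' \<in> ?S" "i' \<noteq> i" for i'
  proof -
    have "sum (\<lambda>i. x i j) (?S - {i}) = 0"
      using s i i1 fin by (simp add: sum.remove)
    moreover have "\<And>l. l \<in> ?S - {i} \<Longrightarrow> 0 \<le> x l j"
      using bin sub by fastforce
    ultimately show ?thesis
      using that fin by (subst (asm) sum_nonneg_eq_0_iff) auto
  qed
  then show ?thesis
    using i i1 out by (intro bexI[of _ i]) auto
qed

text \<open>For \<open>i \<noteq> a j\<close> this is the nonnegative cost change of moving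
  \<open>j\<close> to \<open>i\<close>. For \<open>i = a j\<close> the right side exceeds the left
  by the nonnegative self-term \<open>w j * P i j\<close>.\<close>

lemma jump_opt_kernel_le:
  fixes J :: "'j set" and M :: "'m set" and p :: "'m \<Rightarrow> 'j \<Rightarrow> ereal"
  assumes fin: "finite J" "finite M"
    and a: "\<forall>j\<in>J. a j \<in> feasible_machines M p j"
    and P: "\<forall>j\<in>J. \<forall>i\<in>feasible_machines M p j. p i j = ereal (P i j)"
    and P0: "\<And>i j. i \<in> M \<Longrightarrow> j \<in> J \<Longrightarrow> 0 \<le> P i j"
    and x: "\<forall>i\<in>M. \<forall>j\<in>J. x i j = (if i = a j then 1 else 0)"
    and w: "\<forall>j\<in>J. 0 \<le> w j"
    and ord: "\<forall>i\<in>M. smith_order J w p i (prec i)"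
    and opt: "jump_opt J M w p prec x"
    and G: "\<And>i j k. G i j k = w j * w k * min (P i j / w j) (P i k / w k)"
    and j: "j \<in> J" and i: "i \<in> feasible_machines M p j"
  shows "(\<Sum>k\<in>J. if a k = a j then G (a j) j k else 0) \<le>
    w j * P i j + (\<Sum>k\<in>J. if a k = i then G i j k else 0)"
proof -
  have iM: "i \<in> M" using i by (simp add: feasible_machines_def)
  have Gjj: "G i j j = w j * P i j" by (simp add: G)
  have Gjj0: "0 \<le> G i j j" using Gjj P0 iM j w by simp
  show ?thesis
  proof (cases "i = a j")
    case True
    then show ?thesis using Gjj Gjj0 by (simp cong: sum.cong if_cong)
  next
    case False
    let ?b = "a(j := i)"
    have aM: "\<forall>k\<in>J. a k \<in> M" "\<forall>k\<in>J. ?b k \<in> M"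
      using a iM by (auto simp: feasible_machines_def)
    have Pa: "\<forall>k\<in>J. p (a k) k = ereal (P (a k) k)" "\<forall>k\<in>J. p (?b k) k = ereal (P (?b k) k)"
      using P a i by auto
    have xb: "\<forall>i'\<in>M. \<forall>k\<in>J. move_job x j i i' k = (if i' = ?b k then 1 else 0)"
      using x by (auto simp: move_job_def)
    have "\<not> schedule_cost J M w p prec (move_job x j i) < schedule_cost J M w p prec x"
      using opt i j x iM False by (auto simp: jump_opt_def)
    then have "kernel_cost J a G \<le> kernel_cost J ?b G"
      using schedule_cost_eq_kernel_cost[where G = G, OF fin aM(1) Pa(1) x w ord G]
        schedule_cost_eq_kernel_cost[where G = G and a = ?b, OF fin aM(2) Pa(2) xb w ord G] by simp
    moreover have "G i j k = G i k j" for i j k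
      by (simp add: G min.commute mult.commute)
    ultimately show ?thesis
      using kernel_cost_move[of J j G i a] fin(1) j False Gjj by simp
  qed
qed

section \<open>Construction and verification of the SDP solution\<close>

theorem theorem6p2:
  fixes J :: "'j set" and M :: "'m set"
    and w :: "'j \<Rightarrow> real" and p :: "'m \<Rightarrow> 'j \<Rightarrow> ereal"
    and prec :: "'m \<Rightarrow> 'j \<Rightarrow> 'j \<Rightarrow> bool"
    and x :: "'m \<Rightarrow> 'j \<Rightarrow> real"
  assumes "finite J" and "finite M"
    and "\<forall>j\<in>J. 0 \<le> w j"
    and "\<forall>i\<in>M. \<forall>j\<in>J. 0 \<le> p i j"
    and "\<forall>j\<in>J. feasible_machines M p j \<noteq> {}"
    and "\<forall>i\<in>M. smith_order J w p i (prec i)"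
    and "jump_opt J M w p prec x"
  shows "\<exists>(d :: nat) (y :: 'j \<Rightarrow> real) (v\<^sub>0 :: real vec) (v :: 'm \<Rightarrow> 'j \<Rightarrow> real vec).
           sdp_sr_feasible J M w p d y v\<^sub>0 v \<and>
           ereal (sdp_sr_objective J y v\<^sub>0) \<ge> ereal (2 / (3 + sqrt 5)) * schedule_cost J M w p prec x"
proof -
  note fin = assms(1,2) and w = assms(3)
  \<comment> \<open>An infinite time becomes 0 here, so \<open>P\<close> is nonnegative on all of
    \<open>M \<times> J\<close>; the cost and the constraints read it at feasible pairs
    only.\<close>
  define P where "P i j = real_of_ereal (p i j)" for i j
  define G where "G i j k = w j * w k * min (P i j / w j) (P i k / w k)" for i j k
  have asg: "assignment J M p x" using assms(7) by (simp add: jump_opt_def)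
  obtain a where a: "\<forall>j\<in>J. a j \<in> feasible_machines M p j"
    and x': "\<forall>j\<in>J. \<forall>i\<in>M. x i j = (if i = a j then 1 else 0)"
    using assignment_machine[OF fin(2) asg] by metis
  have x: "\<forall>i\<in>M. \<forall>j\<in>J. x i j = (if i = a j then 1 else 0)" using x' by blast
  have feasM: "i \<in> M" if "i \<in> feasible_machines M p j" for i j
    using that by (simp add: feasible_machines_def)
  have aM: "\<forall>j\<in>J. a j \<in> M" using a feasM by blast
  have P0: "0 \<le> P i j" if "i \<in> M" "j \<in> J" for i j
    using assms(4) that by (simp add: P_def real_of_ereal_pos)
  have P: "\<forall>j\<in>J. \<forall>i\<in>feasible_machines M p j. p i j = ereal (P i j)"
  proof (intro ballI)
    fix j i assume "j \<in> J" "i \<in> feasible_machines M p j"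
    then have "0 \<le> p i j" "p i j < \<infinity>" using assms(4) by (auto simp: feasible_machines_def)
    then show "p i j = ereal (P i j)" by (cases "p i j") (auto simp: P_def)
  qed
  have G0: "0 \<le> G i j k" if "i \<in> M" "j \<in> J" "k \<in> J" for i j k
    using P0 that w by (simp add: G_def)
  have Gjj: "G i j j = w j * P i j" for i j by (simp add: G_def)
  have cost: "schedule_cost J M w p prec x = ereal (kernel_cost J a G)"
    using P a by (intro schedule_cost_eq_kernel_cost[OF fin aM _ x w assms(6) G_def]) auto
  note local_opt = jump_opt_kernel_le[where G = G, OF fin a P P0 x w assms(6,7) G_def]

  obtain d and f :: "nat \<Rightarrow> 'm \<times> 'j \<Rightarrow> real" where f:
    "\<forall>s\<in>M \<times> J. \<forall>t\<in>M \<times> J. (\<Sum>n<d. f n s * f n t) =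
      (if fst s = fst t then min (P (fst s) (snd s) / w (snd s)) (P (fst t) (snd t) / w (snd t)) else 0)"
    using ex_gram_min_blocks[of "M \<times> J" "\<lambda>s. P (fst s) (snd s) / w (snd s)" fst] fin P0 w by auto
  \<comment> \<open>Scaling by \<open>w j\<close> turns the minimum of the ratios into
    \<open>G\<close>. A job of weight 0 gets the zero vector, whatever the value of the division by
    0.\<close>
  define \<phi> where "\<phi> i j n = w j * f n (i, j)" for i j n
  have gram: "(\<Sum>n<d. \<phi> i j n * \<phi> i' k n) = (if i = i' then G i j k else 0)"
    if "i \<in> M" "i' \<in> M" "j \<in> J" "k \<in> J" for i i' j k
  proof -
    have "(\<Sum>n<d. \<phi> i j n * \<phi> i' k n) = w j * w k * (\<Sum>n<d. f n (i, j) * f n (i', k))"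
      by (simp add: \<phi>_def sum_distrib_left mult_ac)
    then show ?thesis using f that by (simp add: G_def)
  qed
  define F where "F n = (\<Sum>k\<in>J. \<phi> (a k) k n)" for n
  \<comment> \<open>The inner product of \<open>F\<close> with \<open>\<phi> i j\<close>: only jobs
    placed on \<open>i\<close> contribute.\<close>
  define Y where "Y i j = (\<Sum>k\<in>J. if a k = i then G i j k else 0)" for i j
  have F_phi: "(\<Sum>n<d. F n * \<phi> i j n) = Y i j" if "i \<in> M" "j \<in> J" for i j
  proof -
    have "(\<Sum>n<d. F n * \<phi> i j n) = (\<Sum>k\<in>J. \<Sum>n<d. \<phi> i j n * \<phi> (a k) k n)"
      by (subst sum.swap) (simp add: F_def sum_distrib_left mult.commute)
    also have "\<dots> = Y i j"
      unfolding Y_def using gram aM that by (intro sum.cong) auto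
    finally show ?thesis .
  qed
  have F_F: "(\<Sum>n<d. F n * F n) = (\<Sum>j\<in>J. Y (a j) j)"
  proof -
    have "(\<Sum>n<d. F n * F n) = (\<Sum>n<d. \<Sum>j\<in>J. F n * \<phi> (a j) j n)"
      by (simp add: F_def sum_distrib_left)
    also have "\<dots> = (\<Sum>j\<in>J. \<Sum>n<d. F n * \<phi> (a j) j n)"
      by (rule sum.swap)
    finally show ?thesis using F_phi aM by simp
  qed

  \<comment> \<open>With \<open>s = \<alpha> * \<alpha>\<close> the objective factor is
    \<open>3 / 2 - 5 * s / 8 - 1 / (2 * s)\<close>; its derivative vanishes when
    \<open>s * s = 4 / 5\<close>.\<close>
  define s :: real where "s = 2 / sqrt 5"
  define \<alpha> where "\<alpha> = sqrt s"
  define \<beta> where "\<beta> = (1 - s / 2) / \<alpha>"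
  have s: "0 < s" "s \<le> 1" by (auto simp: s_def real_le_rsqrt)
  have \<alpha>: "0 < \<alpha>" "\<alpha> * \<alpha> = s" using s by (auto simp: \<alpha>_def)
  have \<alpha>\<beta>: "\<alpha> * \<beta> = 1 - s / 2" using \<alpha> by (simp add: \<beta>_def)
  have \<beta>\<beta>: "\<beta> * \<beta> = (1 - s / 2)\<^sup>2 / s"
    using \<alpha>(2) by (simp add: \<beta>_def power2_eq_square)
  have const: "(1 - s / 2) - \<beta> * \<beta> / 2 = 2 / (3 + sqrt 5)"
  proof -
    have "(1 - s / 2) - \<beta> * \<beta> / 2 = 3 / 2 - 5 * s / 8 - 1 / (2 * s)"
      unfolding \<beta>\<beta> using s by (simp add: field_simps power2_eq_square)
    also have "\<dots> = (3 - sqrt 5) / 2"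
      by (simp add: s_def field_simps)
    also have "\<dots> = 2 / (3 + sqrt 5)"
    proof -
      have "3 + sqrt 5 \<noteq> 0" by (smt (verit) real_sqrt_ge_zero)
      then show ?thesis by (simp add: field_simps)
    qed
    finally show ?thesis .
  qed

  define v where "v i j = vec d (\<lambda>n. \<alpha> * \<phi> i j n)" for i j
  define v0 where "v0 = vec d (\<lambda>n. \<beta> * F n)"
  define y where "y j = (1 - s / 2) * Y (a j) j" for j
  have vv: "v i j \<bullet> v i' k = s * (if i = i' then G i j k else 0)"
    if "i \<in> M" "i' \<in> M" "j \<in> J" "k \<in> J" for i i' j k
  proof -
    have "v i j \<bullet> v i' k = \<alpha> * \<alpha> * (\<Sum>n<d. \<phi> i j n * \<phi> i' k n)"
      by (simp add: v_def scalar_prod_def sum_distrib_left atLeast0LessThan mult_ac)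
    then show ?thesis using gram[OF that] \<alpha> by simp
  qed
  have v0v: "v0 \<bullet> v i j = (1 - s / 2) * Y i j" if "i \<in> M" "j \<in> J" for i j
  proof -
    have "v0 \<bullet> v i j = \<alpha> * \<beta> * (\<Sum>n<d. F n * \<phi> i j n)"
      by (simp add: v_def v0_def scalar_prod_def sum_distrib_left atLeast0LessThan mult_ac)
    then show ?thesis using F_phi[OF that] \<alpha>\<beta> by simp
  qed
  have v0v0: "v0 \<bullet> v0 = \<beta> * \<beta> * (\<Sum>j\<in>J. Y (a j) j)"
  proof -
    have "v0 \<bullet> v0 = \<beta> * \<beta> * (\<Sum>n<d. F n * F n)"
      by (simp add: v0_def scalar_prod_def sum_distrib_left atLeast0LessThan mult_ac)
    then show ?thesis using F_F by simp
  qed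

  have "sdp_sr_feasible J M w p d y v0 v"
    unfolding sdp_sr_feasible_def
  proof (intro conjI ballI impI)
    show "v0 \<in> carrier_vec d" "\<And>i j. v i j \<in> carrier_vec d"
      by (simp_all add: v0_def v_def)
  next
    fix j i assume j: "j \<in> J" and i: "i \<in> feasible_machines M p j"
    have "Y (a j) j \<le> w j * P i j + Y i j"
      using local_opt[OF _ _ j i] by (simp add: Y_def)
    \<comment> \<open>Subtracting half the squared norm leaves \<open>w j * P i j\<close> with the
      factor \<open>1 - s / 2\<close>. The choice of \<open>\<beta>\<close> gives \<open>Y\<close>
      the same factor, so the constraint is a scaled copy of local optimality.\<close>
    then have "(1 - s / 2) * Y (a j) j \<le> (1 - s / 2) * (w j * P i j + Y i j)"
      using s by (intro mult_left_mono) auto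
    then have "y j \<le> w j * P i j - 1 / 2 * (v i j \<bullet> v i j) + v0 \<bullet> v i j"
      unfolding vv[OF feasM[OF i] feasM[OF i] j j] v0v[OF feasM[OF i] j]
      by (simp add: y_def Gjj algebra_simps)
    moreover have "p i j = ereal (P i j)" using P i j by blast
    ultimately show "ereal (y j) \<le>
        ereal (w j) * p i j - ereal (1 / 2 * (v i j \<bullet> v i j)) + ereal (v0 \<bullet> v i j)"
      by simp
  next
    fix j k i i'
    assume j: "j \<in> J" and k: "k \<in> J" and i: "i \<in> feasible_machines M p j"
      and i': "i' \<in> feasible_machines M p k"
    show "ereal (v i j \<bullet> v i' k) \<le>
      (if i = i' then ereal (w j * w k) * min (smith_ratio w p i j) (smith_ratio w p i k) else 0)"
    proof (cases "i = i'")
      case True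
      \<comment> \<open>If a weight is 0, the \<open>ereal\<close> product is 0 even when the
        minimum is infinite, in agreement with \<open>G\<close>.\<close>
      have "ereal (w j * w k) * min (smith_ratio w p i j) (smith_ratio w p i k) = ereal (G i j k)"
      proof (cases "w j = 0 \<or> w k = 0")
        case False
        then have "smith_ratio w p i j = ereal (P i j / w j)" "smith_ratio w p i k = ereal (P i k / w k)"
          using P i i' j k True by (auto simp: smith_ratio_def)
        then show ?thesis by (simp add: G_def min_def)
      qed (auto simp: G_def simp flip: zero_ereal_def)
      moreover have "s * G i j k \<le> 1 * G i j k"
        using s G0 feasM i j k by (intro mult_right_mono) auto
      ultimately show ?thesis
        using True vv feasM i i' j k by simp
    qed (use vv feasM i i' j k in simp)
  qed
  moreover have "2 / (3 + sqrt 5) * kernel_cost J a G \<le> sdp_sr_objective J y v0"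
  proof -
    \<comment> \<open>Kernel entries are nonnegative, so each diagonal entry is at most its row sum;
      hence the cost is at most the full double sum, the squared norm of \<open>F\<close>.\<close>
    have "(\<Sum>j\<in>J. machine_kernel a G j j) \<le> (\<Sum>j\<in>J. \<Sum>k\<in>J. machine_kernel a G j k)"
    proof (intro sum_mono member_le_sum)
      show "0 \<le> machine_kernel a G j k" if "j \<in> J" "k \<in> J - {j}" for j k
        using that G0 aM by (simp add: machine_kernel_def)
    qed (use fin in auto)
    then have "kernel_cost J a G \<le> (\<Sum>j\<in>J. Y (a j) j)"
      by (simp add: kernel_cost_def machine_kernel_def Y_def)
    then have "2 / (3 + sqrt 5) * kernel_cost J a G \<le> 2 / (3 + sqrt 5) * (\<Sum>j\<in>J. Y (a j) j)"
      by (intro mult_left_mono) auto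
    also have "\<dots> = sdp_sr_objective J y v0"
      unfolding const[symmetric] sdp_sr_objective_def v0v0 y_def sum_distrib_left[symmetric]
      by (simp add: algebra_simps)
    finally show ?thesis .
  qed
  ultimately show ?thesis
    unfolding cost by (intro exI[of _ d] exI[of _ y] exI[of _ v0] exI[of _ v]) simp
qed

end
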